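(* Let $\Delta$ be a dynamic theory and $\Delta^{h}$ its havoc lift. Then $\Delta^{h}$ is a dynamic theory.
   Context: A dynamic theory $\Delta$ consists of: pairwise disjoint sets $\mathcal V$ (variables), $\mathcal A$ (atoms), $\mathcal P$ (programs); a nonempty set $U$; a nonempty set $S$ of states with $\mathrm{val}:S\times\mathcal V\to U$ satisfying interpolation (for all $\mu,\nu\in S$, $W\subseteq\mathcal V$ there is $\omega\in S$ agreeing with $\mu$ on $W$ and with $\nu$ outside $W$); $\mathcal E_A:\mathcal A\to2^S$ and $\mathrm{FV}_A:\mathcal A\to 2^{\mathcal V}$ with $\mathrm{FV}_A(a)$ finite and states agreeing on $\mathrm{FV}_A(a)$ both in or both out of $\mathcal E_A(a)$; $\mathcal E_P:\mathcal P\to 2^{S\times S}$ and $\mathrm{FV}_P:\mathcal P\to2^{\mathcal V}$ with $\mathrm{FV}_P(p)$ finite, overapproximation (for all $W\supseteq\mathrm{FV}_P(p)$: if $\mu=_W\nu$ and $(\mu,\omega)\in\mathcal E_P(p)$ then some $\tilde\omega$ has $(\nu,\tilde\omega)\in\mathcal E_P(p)$, $\omega=_W\tilde\omega$) and extensionality (if $\mu=_{\mathcal V}\nu$ then $(\mu,\omega)\in\mathcal E_P(p)\iff(\nu,\omega)\in\mathcal E_P(p)$). $\mu=_W\nu$ means $\mathrm{val}(\mu,v)=\mathrm{val}(\nu,v)$ for all $v\in W$. The havoc lift $\Delta^h$ has the same components as $\Delta$ except: programs $\mathcal P^h=\mathcal P\,\dot\cup\,\{v:=*\mid v\in\mathcal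 V\}$ (disjoint union of new syntactic programs); $\mathcal E_P^h(p)=\mathcal E_P(p)$ and $\mathrm{FV}_P^h(p)=\mathrm{FV}_P(p)$ for $p\in\mathcal P$; $\mathcal E_P^h(v:=* )=\{(\mu,\nu)\in S^2:\mu=_{\mathcal V\setminus\{v\}}\nu\}$ and $\mathrm{FV}_P^h(v:=* )=\emptyset$. *)

theory Defs
  imports Main
begin

(* Variables, atoms and programs are sets of symbols of one common type 'x, so that their
   disjointness is an explicit requirement. The functions of a theory matter only on the
   carriers: val on states and vars, atom_sem and atom_fv on atoms, prog_sem and prog_fv
   on progs. *)
record ('x, 'u, 's) dyn_theory =
  vars :: "'x set"
  atoms :: "'x set"
  progs :: "'x set"
  univ :: "'u set"
  states :: "'s set"
  val :: "'s \<Rightarrow> 'x \<Rightarrow> 'u"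
  atom_sem :: "'x \<Rightarrow> 's set"
  atom_fv :: "'x \<Rightarrow> 'x set"
  prog_sem :: "'x \<Rightarrow> ('s \<times> 's) set"
  prog_fv :: "'x \<Rightarrow> 'x set"

definition agree :: "('x, 'u, 's) dyn_theory \<Rightarrow> 'x set \<Rightarrow> 's \<Rightarrow> 's \<Rightarrow> bool" where
  "agree D W \<mu> \<nu> \<longleftrightarrow> (\<forall>v\<in>W. val D \<mu> v = val D \<nu> v)"

locale dynamic_theory =
  fixes D :: "('x, 'u, 's) dyn_theory"
  assumes vars_atoms_disjoint: "vars D \<inter> atoms D = {}"
    and vars_progs_disjoint: "vars D \<inter> progs D = {}"
    and atoms_progs_disjoint: "atoms D \<inter> progs D = {}"
    and univ_nonempty: "univ D \<noteq> {}"
    and states_nonempty: "states D \<noteq> {}"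
    and val_in_univ: "\<lbrakk>\<mu> \<in> states D; v \<in> vars D\<rbrakk> \<Longrightarrow> val D \<mu> v \<in> univ D"
    and interpolation:
      "\<lbrakk>\<mu> \<in> states D; \<nu> \<in> states D; W \<subseteq> vars D\<rbrakk>
        \<Longrightarrow> \<exists>\<omega>\<in>states D. agree D W \<omega> \<mu> \<and> agree D (vars D - W) \<omega> \<nu>"
    and atom_sem_states: "a \<in> atoms D \<Longrightarrow> atom_sem D a \<subseteq> states D"
    and atom_fv_vars: "a \<in> atoms D \<Longrightarrow> atom_fv D a \<subseteq> vars D"
    and atom_fv_finite: "a \<in> atoms D \<Longrightarrow> finite (atom_fv D a)"
    and atom_coincidence:
      "\<lbrakk>a \<in> atoms D; \<mu> \<in> states D; \<nu> \<in> states D; agree D (atom_fv D a) \<mu> \<nu>\<rbrakk>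
        \<Longrightarrow> \<mu> \<in> atom_sem D a \<longleftrightarrow> \<nu> \<in> atom_sem D a"
    and prog_sem_states: "p \<in> progs D \<Longrightarrow> prog_sem D p \<subseteq> states D \<times> states D"
    and prog_fv_vars: "p \<in> progs D \<Longrightarrow> prog_fv D p \<subseteq> vars D"
    and prog_fv_finite: "p \<in> progs D \<Longrightarrow> finite (prog_fv D p)"
    and overapproximation:
      "\<lbrakk>p \<in> progs D; prog_fv D p \<subseteq> W; W \<subseteq> vars D;
        \<mu> \<in> states D; \<nu> \<in> states D; \<omega> \<in> states D;
        agree D W \<mu> \<nu>; (\<mu>, \<omega>) \<in> prog_sem D p\<rbrakk>
        \<Longrightarrow> \<exists>\<omega>'\<in>states D. (\<nu>, \<omega>') \<in> prog_sem D p \<and> agree D W \<omega> \<omega>'"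
    and extensionality:
      "\<lbrakk>p \<in> progs D; \<mu> \<in> states D; \<nu> \<in> states D; \<omega> \<in> states D; agree D (vars D) \<mu> \<nu>\<rbrakk>
        \<Longrightarrow> (\<mu>, \<omega>) \<in> prog_sem D p \<longleftrightarrow> (\<nu>, \<omega>) \<in> prog_sem D p"

(* Symbols of the havoc lift: Old x is the symbol x of the original theory, Havoc v is the
   new program v := *. This makes every v := * distinct from all symbols of the original
   theory, whatever type those have. *)
datatype 'x havoc_sym = Old (old: 'x) | Havoc 'x

(* The value of old on Havoc symbols is unspecified and never matters: vars and atoms of the
   lift contain only Old symbols. *)
definition havoc_lift :: "('x, 'u, 's) dyn_theory \<Rightarrow> ('x havoc_sym, 'u, 's) dyn_theory" where
  "havoc_lift D =
    \<lparr> vars = Old ` vars D,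
      atoms = Old ` atoms D,
      progs = Old ` progs D \<union> Havoc ` vars D,
      univ = univ D,
      states = states D,
      val = (\<lambda>\<mu> x. val D \<mu> (old x)),
      atom_sem = (\<lambda>x. atom_sem D (old x)),
      atom_fv = (\<lambda>x. Old ` atom_fv D (old x)),
      prog_sem = (\<lambda>x. case x of
          Old p \<Rightarrow> prog_sem D p
        | Havoc v \<Rightarrow> {(\<mu>, \<nu>). \<mu> \<in> states D \<and> \<nu> \<in> states D \<and> agree D (vars D - {v}) \<mu> \<nu>}),
      prog_fv = (\<lambda>x. case x of Old p \<Rightarrow> Old ` prog_fv D p | Havoc v \<Rightarrow> {}) \<rparr>"

end

theory Submission
  imports Defs
begin

text \<open>The lift only renames the data of \<open>D\<close> along the injection
  \<open>Old\<close>, so the conditions on variables, atoms and old programs carry over, and the new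
  symbols are kept apart by the constructor \<open>Havoc\<close>. What remains concerns the programs
  v := *. Their extensionality is immediate, since their runs depend only on values of variables.
  The real point is overapproximation, where the empty \<open>prog_fv\<close> forces the claim for
  every set of variables \<open>W\<close>; interpolation in \<open>D\<close> settles it in
  \<open>havoc_overapproximation\<close>.\<close>

lemma havoc_lift_simps [simp]:
  "vars (havoc_lift D) = Old ` vars D"
  "atoms (havoc_lift D) = Old ` atoms D"
  "progs (havoc_lift D) = Old ` progs D \<union> Havoc ` vars D"
  "univ (havoc_lift D) = univ D"
  "states (havoc_lift D) = states D"
  "val (havoc_lift D) \<mu> x = val D \<mu> (old x)"
  "atom_sem (havoc_lift D) x = atom_sem D (old x)"
  "atom_fv (havoc_lift D) x = Old ` atom_fv D (old x)"
  "prog_sem (havoc_lift D) (Old p) = prog_sem D p"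
  "prog_sem (havoc_lift D) (Havoc v) =
    {(\<mu>, \<nu>). \<mu> \<in> states D \<and> \<nu> \<in> states D \<and> agree D (vars D - {v}) \<mu> \<nu>}"
  "prog_fv (havoc_lift D) (Old p) = Old ` prog_fv D p"
  "prog_fv (havoc_lift D) (Havoc v) = {}"
  by (simp_all add: havoc_lift_def)

text \<open>Every set of variables of the lift is an image under \<open>Old\<close>, so this turns
  each agreement condition on the lift into one on \<open>D\<close>.\<close>

lemma agree_havoc_lift [simp]: "agree (havoc_lift D) (Old ` W) \<mu> \<nu> \<longleftrightarrow> agree D W \<mu> \<nu>"
  by (simp add: agree_def)

lemma inj_Old: "inj_on Old A"
  by (simp add: inj_on_def)

context dynamic_theory
begin

(* The run from \<nu> must end in a state that equals \<omega> on W and \<nu> elsewhere, which is exactly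
   what interpolation provides. *)
lemma havoc_overapproximation:
  assumes W: "W \<subseteq> vars D" and states: "\<nu> \<in> states D" "\<omega> \<in> states D"
    and "agree D W \<mu> \<nu>" and "agree D (vars D - {v}) \<mu> \<omega>"
  shows "\<exists>\<omega>'\<in>states D. agree D (vars D - {v}) \<nu> \<omega>' \<and> agree D W \<omega> \<omega>'"
proof -
  obtain \<omega>' where "\<omega>' \<in> states D" "agree D W \<omega>' \<omega>" "agree D (vars D - W) \<omega>' \<nu>"
    using interpolation[OF states(2,1) W] by blast
  \<comment> \<open>Let x be a variable other than \<open>v\<close>. If x is in \<open>W\<close>,
    the values at x coincide along \<omega>', \<omega>, \<mu>, \<nu>, the middle step because the
    given run changes only \<open>v\<close>. If x is outside \<open>W\<close>, \<omega>' copies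
    \<nu> by choice.\<close>
  moreover from this have "agree D (vars D - {v}) \<nu> \<omega>'"
    using assms by (auto simp: agree_def) (metis DiffI singletonD subsetD)
  ultimately show ?thesis
    by (auto simp: agree_def)
qed

end

theorem mainTheorem5:
  fixes D :: "('x, 'u, 's) dyn_theory"
  assumes "dynamic_theory D"
  shows "dynamic_theory (havoc_lift D)"
proof -
  interpret dynamic_theory D by fact
  let ?H = "havoc_lift D"
  show ?thesis
  proof
    show "vars ?H \<inter> atoms ?H = {}" "vars ?H \<inter> progs ?H = {}" "atoms ?H \<inter> progs ?H = {}"
      using vars_atoms_disjoint vars_progs_disjoint atoms_progs_disjoint by auto
    show "univ ?H \<noteq> {}" "states ?H \<noteq> {}"
      using univ_nonempty states_nonempty by simp_all
    show "val ?H \<mu> v \<in> univ ?H" if "\<mu> \<in> states ?H" "v \<in> vars ?H" for \<mu> v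
      using that val_in_univ by auto
    show "\<exists>\<omega>\<in>states ?H. agree ?H W \<omega> \<mu> \<and> agree ?H (vars ?H - W) \<omega> \<nu>"
      if "\<mu> \<in> states ?H" "\<nu> \<in> states ?H" and W: "W \<subseteq> vars ?H" for \<mu> \<nu> W
    proof -
      obtain W' where "W' \<subseteq> vars D" "W = Old ` W'"
        using W by (auto simp: subset_image_iff)
      \<comment> \<open>Injectivity of \<open>Old\<close> makes the complement of \<open>W\<close>
        the image of \<open>vars D - W'\<close>, so interpolation in \<open>D\<close> applies to
        \<open>W'\<close>.\<close>
      then show ?thesis
        using that interpolation[of \<mu> \<nu> W'] by (simp flip: image_set_diff[OF inj_Old])
    qed
    show "atom_sem ?H a \<subseteq> states ?H" "atom_fv ?H a \<subseteq> vars ?H" "finite (atom_fv ?H a)"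
      if "a \<in> atoms ?H" for a
      using that
      by (auto simp: atom_fv_finite dest: atom_sem_states[THEN subsetD] atom_fv_vars[THEN subsetD])
    show "\<mu> \<in> atom_sem ?H a \<longleftrightarrow> \<nu> \<in> atom_sem ?H a"
      if "a \<in> atoms ?H" "\<mu> \<in> states ?H" "\<nu> \<in> states ?H" "agree ?H (atom_fv ?H a) \<mu> \<nu>" for a \<mu> \<nu>
      using that atom_coincidence by auto
    show "prog_sem ?H p \<subseteq> states ?H \<times> states ?H" "prog_fv ?H p \<subseteq> vars ?H" "finite (prog_fv ?H p)"
      if "p \<in> progs ?H" for p
      using that
      by (auto simp: prog_fv_finite intro!: imageI dest: prog_sem_states[THEN subsetD] prog_fv_vars[THEN subsetD])
    show "\<exists>\<omega>'\<in>states ?H. (\<nu>, \<omega>') \<in> prog_sem ?H p \<and> agree ?H W \<omega> \<omega>'"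
      if "p \<in> progs ?H" "prog_fv ?H p \<subseteq> W" and W: "W \<subseteq> vars ?H" and
        "\<mu> \<in> states ?H" "\<nu> \<in> states ?H" "\<omega> \<in> states ?H"
        "agree ?H W \<mu> \<nu>" "(\<mu>, \<omega>) \<in> prog_sem ?H p" for p W \<mu> \<nu> \<omega>
    proof -
      obtain W' where W': "W' \<subseteq> vars D" "W = Old ` W'"
        using W by (auto simp: subset_image_iff)
      show ?thesis
      proof (cases p)
        case (Old q)
        then show ?thesis
          using that W' overapproximation[of q W' \<mu> \<nu> \<omega>] by auto
      next
        \<comment> \<open>The empty \<open>prog_fv\<close> does not constrain \<open>W'\<close>,
          which may contain \<open>v\<close> or not.\<close>
        case (Havoc v)
        then show ?thesis
          using that W' havoc_overapproximation[of W' \<nu> \<omega> \<mu> v] by simp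
      qed
    qed
    show "(\<mu>, \<omega>) \<in> prog_sem ?H p \<longleftrightarrow> (\<nu>, \<omega>) \<in> prog_sem ?H p"
      if "p \<in> progs ?H" "\<mu> \<in> states ?H" "\<nu> \<in> states ?H" "\<omega> \<in> states ?H"
        "agree ?H (vars ?H) \<mu> \<nu>" for p \<mu> \<nu> \<omega>
    proof (cases p)
      case (Old q)
      then show ?thesis
        using that extensionality[of q \<mu> \<nu> \<omega>] by auto
    next
      case (Havoc v)
      \<comment> \<open>Being equal to \<omega> off \<open>v\<close> is a condition on values of
        variables, and \<mu> and \<nu> share all of these.\<close>
      then show ?thesis
        using that by (auto simp: agree_def)
    qed
  qed
qed

end
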